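(* Let $n\ge 2$, $N=\{1,\dots,n\}$, and let $A=[a_{ij}]\in\mathbb{C}^{n,n}$ be a Nekrasov matrix with $$|a_{11}|-h_1(A)<\min_{i\ne 1}\left(|a_{ii}|-h_i(A)\right).$$ Then $$\min\left\{\frac{\max\{\mu,1\}}{\min\left\{\mu|a_{11}|-h_1(A),\ \min\limits_{i\ne 1}(|a_{ii}|-h_i(A))\right\}}:\ \mu\in\left(1,\frac{\min\limits_{i\ne 1}(|a_{ii}|-h_i(A))}{|a_{11}|-h_1(A)}\right)\right\}=\frac{\min\limits_{i\ne 1}(|a_{ii}|-h_i(A))+h_1(A)}{|a_{11}|\min\limits_{i\ne 1}(|a_{ii}|-h_i(A))}.$$ Furthermore, $$\|A^{-1}\|_\infty\le\frac{\max\limits_{i\in N}z_i(A)\left(\min\limits_{i\ne 1}(|a_{ii}|-h_i(A))+h_1(A)\right)}{|a_{11}|\min\limits_{i\ne 1}(|a_{ii}|-h_i(A))}<\frac{\max\limits_{i\in N}z_i(A)}{\min\limits_{i\in N}(|a_{ii}|-h_i(A))}.$$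
   Context: For $A=[a_{ij}]\in\mathbb{C}^{n,n}$ and $N=\{1,\dots,n\}$, define recursively $h_1(A)=\sum_{j\neq 1}|a_{1j}|$ and $h_i(A)=\sum_{j=1}^{i-1}\frac{|a_{ij}|}{|a_{jj}|}h_j(A)+\sum_{j=i+1}^{n}|a_{ij}|$ for $i=2,\dots,n$. Define $z_1(A)=1$ and $z_i(A)=\sum_{j=1}^{i-1}\frac{|a_{ij}|}{|a_{jj}|}z_j(A)+1$ for $i=2,\dots,n$. $A$ is called a Nekrasov matrix if $|a_{ii}|>h_i(A)$ for every $i\in N$. $\|\cdot\|_\infty$ is the matrix norm induced by the vector infinity norm (maximum absolute row sum). "$i\neq 1$" means $i\in N\setminus\{1\}$.
   Formalization: The final strict inequality is proved only when h_1(A) ≠ 0, with ≤ proved always; as printed it fails when h_1(A) = 0, e.g. for A = diag(1,2), where both sides equal 1. *)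

theory Defs
  imports Complex_Main "Jordan_Normal_Form.Matrix"
begin

text \<open>
  Rows and columns of a matrix of type \<^typ>\<open>'a mat\<close> are numbered from 0, so the index
  \<open>i \<in> {1, \<dots>, n}\<close> of the mathematical text is \<open>i - 1\<close> here. In particular \<open>a\<^sub>1\<^sub>1\<close> is
  \<open>A $$ (0,0)\<close>, and \<open>i \<noteq> 1\<close> becomes \<open>i \<in> {1..<n}\<close>.
\<close>

text \<open>
  In the two recursions the sum over \<open>j < i\<close> is empty for the first row, so a single equation
  covers both the initial value and the recursive case.
\<close>

fun row_h :: "complex mat \<Rightarrow> nat \<Rightarrow> real" where
  "row_h A i =
     (\<Sum>j\<in>{..<i}. cmod (A $$ (i,j)) / cmod (A $$ (j,j)) * row_h A j)
     + (\<Sum>j\<in>{i<..<dim_col A}. cmod (A $$ (i,j)))"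

fun row_z :: "complex mat \<Rightarrow> nat \<Rightarrow> real" where
  "row_z A i = (\<Sum>j\<in>{..<i}. cmod (A $$ (i,j)) / cmod (A $$ (j,j)) * row_z A j) + 1"

declare row_h.simps [simp del] row_z.simps [simp del]

definition nekrasov :: "complex mat \<Rightarrow> bool" where
  "nekrasov A \<longleftrightarrow> square_mat A \<and> (\<forall>i<dim_row A. cmod (A $$ (i,i)) > row_h A i)"

text \<open>Both norms are only meaningful in positive dimension (\<open>Max {}\<close> is unspecified).\<close>

definition inf_norm_vec :: "complex vec \<Rightarrow> real" where
  "inf_norm_vec x = (MAX i\<in>{..<dim_vec x}. cmod (x $ i))"

definition inf_norm_mat :: "complex mat \<Rightarrow> real" where
  "inf_norm_mat A =
     (SUP x\<in>{x \<in> carrier_vec (dim_col A). inf_norm_vec x = 1}. inf_norm_vec (A *\<^sub>v x))"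

lemma row_h_first: "row_h A 0 = (\<Sum>j\<in>{..<dim_col A} - {0}. cmod (A $$ (0,j)))"
proof -
  have "{0<..<dim_col A} = {..<dim_col A} - {0}" by auto
  then show ?thesis by (simp add: row_h.simps[of A 0])
qed

lemma row_z_first: "row_z A 0 = 1"
  by (simp add: row_z.simps[of A 0])

lemma cmod_le_inf_norm_vec: "i < dim_vec x \<Longrightarrow> cmod (x $ i) \<le> inf_norm_vec x"
  unfolding inf_norm_vec_def by (rule Max_ge) auto

lemma inf_norm_vec_le_iff:
  "dim_vec x > 0 \<Longrightarrow> inf_norm_vec x \<le> c \<longleftrightarrow> (\<forall>i<dim_vec x. cmod (x $ i) \<le> c)"
  unfolding inf_norm_vec_def by (subst Max_le_iff) auto

theorem inf_norm_mat_row_sum: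
  assumes A: "A \<in> carrier_mat m n" and m: "m > 0" and n: "n > 0"
  shows "inf_norm_mat A = (MAX i\<in>{..<m}. \<Sum>j<n. cmod (A $$ (i,j)))"
proof -
  define R where "R i = (\<Sum>j<n. cmod (A $$ (i,j)))" for i
  define S where "S = {x \<in> carrier_vec n. inf_norm_vec x = 1}"
  have dims: "dim_row A = m" "dim_col A = n" using A by auto
  have entry: "(A *\<^sub>v x) $ i = (\<Sum>j<n. A $$ (i,j) * x $ j)"
    if "x \<in> carrier_vec n" "i < m" for x i
    using that dims by (auto simp: scalar_prod_def lessThan_atLeast0 intro!: sum.cong)
  have upper: "inf_norm_vec (A *\<^sub>v x) \<le> (MAX i\<in>{..<m}. R i)" if x: "x \<in> S" for x
  proof -
    have xc: "x \<in> carrier_vec n" and x1: "inf_norm_vec x = 1" using x by (auto simp: S_def)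
    have "cmod ((A *\<^sub>v x) $ i) \<le> (MAX i\<in>{..<m}. R i)" if i: "i < m" for i
    proof -
      have "cmod ((A *\<^sub>v x) $ i) \<le> (\<Sum>j<n. cmod (A $$ (i,j) * x $ j))"
        unfolding entry[OF xc i] by (rule norm_sum)
      also have "\<dots> \<le> R i"
        unfolding R_def norm_mult
        using cmod_le_inf_norm_vec[of _ x] xc x1
        by (intro sum_mono mult_left_le) auto
      also have "\<dots> \<le> (MAX i\<in>{..<m}. R i)" using i by (intro Max_ge) auto
      finally show ?thesis .
    qed
    then show ?thesis using dims m by (subst inf_norm_vec_le_iff) auto
  qed
  have "(MAX i\<in>{..<m}. R i) \<in> R ` {..<m}" using m by (intro Max_in) auto
  then obtain k where k: "k < m" "(MAX i\<in>{..<m}. R i) = R k" by auto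
  define y where "y = vec n (\<lambda>j. if A $$ (k,j) = 0 then 1 else cnj (sgn (A $$ (k,j))))"
  have yc: "y \<in> carrier_vec n" by (simp add: y_def)
  have ymod: "cmod (y $ j) = 1" if "j < n" for j
    using that by (simp add: y_def norm_sgn)
  have "(\<lambda>j. cmod (y $ j)) ` {..<dim_vec y} = {1}"
    using ymod yc n by (auto simp: image_def)
  then have yS: "y \<in> S" using yc by (simp add: S_def inf_norm_vec_def)
  have "A $$ (k,j) * y $ j = of_real (cmod (A $$ (k,j)))" if "j < n" for j
    using that
    by (auto simp: y_def sgn_div_norm complex_norm_square[symmetric]
          scaleR_conv_of_real field_simps power2_eq_square)
  then have "(A *\<^sub>v y) $ k = of_real (R k)"
    unfolding entry[OF yc k(1)] R_def by simp
  moreover have "R k \<ge> 0" unfolding R_def by (simp add: sum_nonneg)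
  ultimately have "cmod ((A *\<^sub>v y) $ k) = R k" by simp
  then have lower: "R k \<le> inf_norm_vec (A *\<^sub>v y)"
    using cmod_le_inf_norm_vec[of k "A *\<^sub>v y"] k dims by simp
  have "(SUP x\<in>S. inf_norm_vec (A *\<^sub>v x)) = R k"
  proof (rule antisym)
    show "(SUP x\<in>S. inf_norm_vec (A *\<^sub>v x)) \<le> R k"
      using yS upper k by (intro cSUP_least) auto
    have "bdd_above ((\<lambda>x. inf_norm_vec (A *\<^sub>v x)) ` S)" using upper by (rule bdd_aboveI2)
    then show "R k \<le> (SUP x\<in>S. inf_norm_vec (A *\<^sub>v x))"
      using lower yS by (meson cSUP_upper order_trans)
  qed
  then show ?thesis using k(2) by (simp add: inf_norm_mat_def S_def R_def dims)
qed

end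

theory Submission
  imports Defs "Jordan_Normal_Form.Determinant"
begin

text \<open>
  Everything rests on one estimate for a linear system \<open>A x = y\<close> with \<open>|y\<^sub>i| \<le> Y\<close>. Let \<open>M\<close> bound
  the moduli of all entries of \<open>x\<close> except the first. Forward substitution through the rows gives
  \<open>|a\<^sub>i\<^sub>i| |x\<^sub>i| \<le> h\<^sub>i M + z\<^sub>i Y\<close> (\<open>diag_times_entry_le\<close>): the recursions for \<open>h\<close> and \<open>z\<close> are
  what this substitution produces. The first entry needs no bound of its own, because it occurs in
  the later rows only below the diagonal, where its own row estimate replaces it.

  Take \<open>M\<close> to be the largest of these moduli. At a row where it is attained the estimate
  reads \<open>(|a\<^sub>i\<^sub>i| - h\<^sub>i) M \<le> z\<^sub>i Y\<close>, hence \<open>M \<le> zmax Y / \<delta>\<close>. Inserting this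
  into the first row bounds \<open>|x\<^sub>1|\<close> by \<open>(h\<^sub>1 zmax / \<delta> + 1) Y / |a\<^sub>1\<^sub>1|\<close>, and \<open>1 \<le> zmax\<close> turns
  this into \<open>zmax (\<delta> + h\<^sub>1) / (|a\<^sub>1\<^sub>1| \<delta>) Y\<close>. The other entries obey the same bound, since
  \<open>|a\<^sub>1\<^sub>1| \<le> \<delta> + h\<^sub>1\<close> (\<open>nekrasov_solution_bound\<close>). With \<open>Y = 0\<close> this shows that \<open>A\<close> is
  invertible, and with \<open>x = A\<^sup>-\<^sup>1 y\<close> it is the norm bound.

  The minimum over \<open>\<mu>\<close> explains the constant. Multiplying the first column of \<open>A\<close> by \<open>\<mu>\<close>
  changes neither the \<open>h\<^sub>i\<close> nor the \<open>z\<^sub>i\<close>, only the first row gap, and costs at most a factor \<open>\<mu>\<close> in the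
  norm of the inverse. While \<open>\<mu> |a\<^sub>1\<^sub>1| - h\<^sub>1\<close> is the smallest gap, the quotient does not increase
  with \<open>\<mu>\<close>; once \<open>\<delta>\<close> is the smallest, it grows. The optimum is therefore at equality,
  \<open>\<mu> = (\<delta> + h\<^sub>1) / |a\<^sub>1\<^sub>1|\<close> (\<open>scaling_optimum_lower_bound\<close>, \<open>scaling_optimum_attained\<close>), and it
  improves on the unscaled \<open>\<mu> = 1\<close> exactly when \<open>h\<^sub>1 \<noteq> 0\<close>.
\<close>

section \<open>Minimising over the scaling parameter\<close>

text \<open>
  With \<open>m\<close> the denominator, \<open>\<mu> a \<ge> m + h\<close> gives \<open>\<mu> / m \<ge> (1 + h / m) / a\<close>, which
  decreases in \<open>m\<close>, and \<open>m \<le> \<delta>\<close>.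
\<close>

lemma scaling_optimum_lower_bound:
  fixes a h \<delta> \<mu> :: real
  assumes "0 \<le> h" "h < a" "0 < \<delta>" "1 < \<mu>"
  shows "(\<delta> + h) / (a * \<delta>) \<le> max \<mu> 1 / min (\<mu> * a - h) \<delta>"
proof -
  define m where "m = min (\<mu> * a - h) \<delta>"
  have "a < \<mu> * a" using assms by simp
  then have "h < \<mu> * a" using assms by linarith
  then have m: "0 < m" "m \<le> \<delta>" "m + h \<le> \<mu> * a" using assms by (auto simp: m_def)
  have "(\<delta> + h) / (a * \<delta>) = (1 + h / \<delta>) / a" using assms by (simp add: field_simps)
  also have "\<dots> \<le> (1 + h / m) / a"
    using assms m by (intro divide_right_mono add_left_mono divide_left_mono) auto
  also have "\<dots> = (m + h) / a / m" using m assms by (simp add: field_simps)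
  also have "\<dots> \<le> \<mu> / m" using m assms by (intro divide_right_mono) (auto simp: field_simps)
  finally show ?thesis using assms by (simp add: m_def)
qed

text \<open>
  For \<open>h = 0\<close> the optimal \<open>\<mu>\<close> is the excluded right end of the interval, but then the function is
  constant on the interval, so any point of it will do.
\<close>

lemma scaling_optimum_attained:
  fixes a h \<delta> :: real
  assumes "0 \<le> h" "h < a" "a - h < \<delta>"
  shows "(\<delta> + h) / (a * \<delta>) \<in>
    (\<lambda>\<mu>. max \<mu> 1 / min (\<mu> * a - h) \<delta>) ` {1<..<\<delta> / (a - h)}"
proof (cases "h = 0")
  case True
  have "1 < \<delta> / a" using assms True by (simp add: field_simps)
  then obtain \<mu> where \<mu>: "1 < \<mu>" "\<mu> < \<delta> / a" using dense by blast
  then have "\<mu> * a < \<delta>" using assms by (simp add: field_simps)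
  then have "(\<delta> + h) / (a * \<delta>) = max \<mu> 1 / min (\<mu> * a - h) \<delta>"
    using assms True \<mu> by (simp add: field_simps)
  then show ?thesis using \<mu> True by (intro image_eqI[of _ _ \<mu>]) auto
next
  case False
  define \<mu> where "\<mu> = (\<delta> + h) / a"
  have "0 < h * (\<delta> - (a - h))" using assms False by simp
  then have "(\<delta> + h) * (a - h) < \<delta> * a" by (simp add: algebra_simps)
  then have "\<mu> < \<delta> / (a - h)" using assms by (simp add: \<mu>_def field_simps)
  moreover have "1 < \<mu>" using assms by (simp add: \<mu>_def field_simps)
  moreover have "\<mu> * a - h = \<delta>" using assms by (simp add: \<mu>_def)
  ultimately show ?thesis
    using assms by (intro image_eqI[of _ _ \<mu>]) (auto simp: \<mu>_def field_simps)
qed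

section \<open>The quantities of a Nekrasov matrix\<close>

lemma row_h_nonneg: "0 \<le> row_h A i"
proof (induction i rule: less_induct)
  case (less i)
  then show ?case
    by (subst row_h.simps) (intro add_nonneg_nonneg sum_nonneg mult_nonneg_nonneg, auto)
qed

lemma row_z_ge_1: "1 \<le> row_z A i"
proof (induction i rule: less_induct)
  case (less i)
  have "0 \<le> (\<Sum>j\<in>{..<i}. cmod (A $$ (i,j)) / cmod (A $$ (j,j)) * row_z A j)"
    by (intro sum_nonneg mult_nonneg_nonneg) (use less in force)+
  then show ?case by (subst row_z.simps) simp
qed

lemma nekrasov_row_gap_pos:
  assumes "A \<in> carrier_mat n n" "nekrasov A" "i < n"
  shows "row_h A i < cmod (A $$ (i,i))"
  using assms by (auto simp: nekrasov_def)

section \<open>Linear systems with a Nekrasov matrix\<close>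

text \<open>
  Solve row \<open>i\<close> for its diagonal term. Above the diagonal every entry of \<open>x\<close> is at most \<open>M\<close>; below it
  the estimate of row \<open>j\<close>, divided by \<open>|a\<^sub>j\<^sub>j|\<close>, takes over. Column 0 is never above the diagonal,
  so \<open>M\<close> ranges over the other entries.
\<close>

lemma diag_times_entry_le:
  assumes A: "A \<in> carrier_mat n n" and nk: "nekrasov A" and x: "x \<in> carrier_vec n"
    and M: "\<And>j. 0 < j \<Longrightarrow> j < n \<Longrightarrow> cmod (x $ j) \<le> M"
    and Y: "\<And>j. j < n \<Longrightarrow> cmod ((A *\<^sub>v x) $ j) \<le> Y"
    and i: "i < n"
  shows "cmod (A $$ (i,i)) * cmod (x $ i) \<le> row_h A i * M + row_z A i * Y"
  using i
proof (induction i rule: less_induct)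
  case (less i)
  let ?a = "\<lambda>j. cmod (A $$ (i,j))"
  let ?d = "\<lambda>j. cmod (A $$ (j,j))"
  let ?t = "\<lambda>j. A $$ (i,j) * x $ j"
  let ?r = "\<lambda>j. row_h A j * M + row_z A j * Y"
  have split: "{..<n} = insert i ({..<i} \<union> {i<..<n})" using less.prems by auto
  have "(A *\<^sub>v x) $ i = (\<Sum>j<n. ?t j)"
    using A x less.prems by (auto simp: scalar_prod_def lessThan_atLeast0 intro!: sum.cong)
  also have "\<dots> = ?t i + ((\<Sum>j<i. ?t j) + (\<Sum>j\<in>{i<..<n}. ?t j))"
    unfolding split by (subst sum.insert) (auto intro!: sum.union_disjoint)
  finally have "?t i = (A *\<^sub>v x) $ i - (\<Sum>j<i. ?t j) - (\<Sum>j\<in>{i<..<n}. ?t j)" by simp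
  then have "?a i * cmod (x $ i)
      = cmod ((A *\<^sub>v x) $ i - (\<Sum>j<i. ?t j) - (\<Sum>j\<in>{i<..<n}. ?t j))"
    by (simp add: norm_mult[symmetric])
  also have "\<dots> \<le> cmod ((A *\<^sub>v x) $ i) + cmod (\<Sum>j<i. ?t j) + cmod (\<Sum>j\<in>{i<..<n}. ?t j)"
    by (rule order_trans[OF norm_triangle_ineq4 add_right_mono[OF norm_triangle_ineq4]])
  finally have "?a i * cmod (x $ i)
      \<le> cmod ((A *\<^sub>v x) $ i) + cmod (\<Sum>j<i. ?t j) + cmod (\<Sum>j\<in>{i<..<n}. ?t j)" .
  moreover have "cmod ((A *\<^sub>v x) $ i) \<le> Y" using Y less.prems by blast
  moreover have "cmod (\<Sum>j<i. ?t j) \<le> (\<Sum>j<i. ?a j / ?d j * ?r j)"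
  proof (intro sum_norm_le)
    fix j assume "j \<in> {..<i}"
    then have j: "j < i" "j < n" using less.prems by auto
    have "0 < ?d j"
      using nekrasov_row_gap_pos[OF A nk j(2)] row_h_nonneg[of A j] by linarith
    then have "cmod (x $ j) \<le> ?r j / ?d j" using less.IH[OF j] by (simp add: field_simps)
    then have "?a j * cmod (x $ j) \<le> ?a j * (?r j / ?d j)" by (rule mult_left_mono) simp
    then show "cmod (?t j) \<le> ?a j / ?d j * ?r j" by (simp add: norm_mult)
  qed
  moreover have "cmod (\<Sum>j\<in>{i<..<n}. ?t j) \<le> (\<Sum>j\<in>{i<..<n}. ?a j * M)"
    by (intro sum_norm_le) (auto simp: norm_mult intro!: mult_left_mono M)
  ultimately have "?a i * cmod (x $ i)
      \<le> Y + ((\<Sum>j<i. ?a j / ?d j * ?r j) + (\<Sum>j\<in>{i<..<n}. ?a j * M))"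
    by linarith
  also have "\<dots> = row_h A i * M + row_z A i * Y"
  proof -
    have "(\<Sum>j<i. ?a j / ?d j * ?r j)
        = (\<Sum>j<i. ?a j / ?d j * row_h A j) * M + (\<Sum>j<i. ?a j / ?d j * row_z A j) * Y"
      unfolding sum_distrib_right sum.distrib[symmetric]
      by (intro sum.cong refl) (simp add: algebra_simps add_divide_distrib)
    moreover have "(\<Sum>j\<in>{i<..<n}. ?a j * M) = (\<Sum>j\<in>{i<..<n}. ?a j) * M"
      by (simp only: sum_distrib_right)
    moreover have "dim_col A = n" using A by simp
    ultimately show ?thesis
      unfolding row_h.simps[of A i] row_z.simps[of A i] by (simp add: ring_distribs)
  qed
  finally show ?case .
qed

text \<open>
  The previous estimate bounds \<open>M\<close>, the largest modulus outside entry 0, at a row where it is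
  attained. Entry 0 then follows from its own row, which involves the other entries only with total
  weight \<open>row_h A 0\<close>.
\<close>

lemma nekrasov_solution_bound:
  assumes n: "2 \<le> n" and A: "A \<in> carrier_mat n n" and nk: "nekrasov A" and x: "x \<in> carrier_vec n"
    and Y: "\<And>j. j < n \<Longrightarrow> cmod ((A *\<^sub>v x) $ j) \<le> Y"
    and \<delta>: "0 < \<delta>" "\<And>j. 0 < j \<Longrightarrow> j < n \<Longrightarrow> \<delta> \<le> cmod (A $$ (j,j)) - row_h A j"
    and \<zeta>: "\<And>j. j < n \<Longrightarrow> row_z A j \<le> \<zeta>"
    and gap: "cmod (A $$ (0,0)) - row_h A 0 \<le> \<delta>"
    and i: "i < n"
  shows "cmod (x $ i) \<le> \<zeta> * (\<delta> + row_h A 0) / (cmod (A $$ (0,0)) * \<delta>) * Y"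
proof -
  define M where "M = (MAX j\<in>{1..<n}. cmod (x $ j))"
  define a where "a = cmod (A $$ (0,0))"
  define h where "h = row_h A 0"
  have M: "cmod (x $ j) \<le> M" if "0 < j" "j < n" for j
    unfolding M_def using that by (intro Max_ge) auto
  have "M \<in> (\<lambda>j. cmod (x $ j)) ` {1..<n}" unfolding M_def using n by (intro Max_in) auto
  then obtain k where k: "0 < k" "k < n" and Mk: "M = cmod (x $ k)"
    by (auto simp: Suc_le_eq)
  have M0: "0 \<le> M" by (simp add: Mk)
  have Y0: "0 \<le> Y" using Y[OF i] norm_ge_zero order_trans by blast
  have h0: "0 \<le> h" by (simp add: h_def row_h_nonneg)
  have "h < a" using nekrasov_row_gap_pos[OF A nk, of 0] n by (simp add: a_def h_def)
  then have a0: "0 < a" using h0 by linarith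
  have \<zeta>1: "1 \<le> \<zeta>" using \<zeta>[OF i] row_z_ge_1[of A i] by linarith
  have est: "cmod (A $$ (j,j)) * cmod (x $ j) \<le> row_h A j * M + row_z A j * Y" if "j < n" for j
    by (rule diag_times_entry_le[OF A nk x _ _ that]) (auto intro: M Y)
  have "\<delta> * M \<le> (cmod (A $$ (k,k)) - row_h A k) * M"
    using \<delta>(2)[OF k] M0 by (rule mult_right_mono)
  also have "\<dots> \<le> row_z A k * Y" using est[OF k(2)] by (simp add: Mk algebra_simps)
  also have "\<dots> \<le> \<zeta> * Y" using \<zeta>[OF k(2)] Y0 by (rule mult_right_mono)
  finally have \<delta>M: "\<delta> * M \<le> \<zeta> * Y" .
  have "a * \<delta> * cmod (x $ i) \<le> \<zeta> * (\<delta> + h) * Y"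
  proof (cases "i = 0")
    case True
    have "a * cmod (x $ 0) \<le> h * M + Y"
      using est[of 0] n by (simp add: a_def h_def row_z_first)
    then have "\<delta> * (a * cmod (x $ 0)) \<le> \<delta> * (h * M + Y)"
      using \<delta>(1) by (intro mult_left_mono) auto
    also have "\<dots> = h * (\<delta> * M) + \<delta> * (1 * Y)" by (simp add: algebra_simps)
    also have "\<dots> \<le> h * (\<zeta> * Y) + \<delta> * (\<zeta> * Y)"
      using \<delta>(1) \<delta>M \<zeta>1 Y0 h0 by (intro add_mono mult_left_mono mult_right_mono) auto
    finally show ?thesis using True by (simp add: algebra_simps)
  next
    case False
    have "a * (\<delta> * cmod (x $ i)) \<le> a * (\<delta> * M)"
      using False i \<delta>(1) a0 M by (intro mult_left_mono) auto
    also have "\<dots> \<le> a * (\<zeta> * Y)" using \<delta>M a0 by (intro mult_left_mono) auto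
    also have "\<dots> \<le> (\<delta> + h) * (\<zeta> * Y)"
      using gap \<zeta>1 Y0 by (intro mult_right_mono) (auto simp: a_def h_def)
    finally show ?thesis by (simp add: algebra_simps)
  qed
  then show ?thesis
    using a0 \<delta>(1) unfolding a_def[symmetric] h_def[symmetric] by (simp add: field_simps)
qed

section \<open>Invertibility and the norm of the inverse\<close>

lemma invertible_mat_if_trivial_kernel:
  fixes A :: "'a :: field mat"
  assumes A: "A \<in> carrier_mat n n"
    and ker: "\<And>v. v \<in> carrier_vec n \<Longrightarrow> A *\<^sub>v v = 0\<^sub>v n \<Longrightarrow> v = 0\<^sub>v n"
  shows "invertible_mat A"
proof -
  have "det A \<noteq> 0" using det_0_iff_vec_prod_zero_field[OF A] ker by blast
  then have "A \<in> Units (ring_mat TYPE('a) n ())" by (rule det_non_zero_imp_unit[OF A])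
  then obtain B where "B \<in> carrier_mat n n" "B * A = 1\<^sub>m n" "A * B = 1\<^sub>m n"
    by (auto simp: Units_def ring_mat_simps)
  then have "inverts_mat A B" "inverts_mat B A" using A by (auto simp: inverts_mat_def)
  then show ?thesis using A by (auto simp: invertible_mat_def)
qed

lemma inf_norm_inverse_le:
  assumes A: "A \<in> carrier_mat n n" and n: "0 < n"
    and inv: "inverts_mat A B" "inverts_mat B A"
    and bound: "\<And>x i. x \<in> carrier_vec n \<Longrightarrow> (\<And>j. j < n \<Longrightarrow> cmod ((A *\<^sub>v x) $ j) \<le> 1) \<Longrightarrow>
      i < n \<Longrightarrow> cmod (x $ i) \<le> c"
  shows "inf_norm_mat B \<le> c"
proof -
  have AB: "A * B = 1\<^sub>m n" and BA: "B * A = 1\<^sub>m (dim_row B)"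
    using inv A by (auto simp: inverts_mat_def)
  have "dim_col B = n" using arg_cong[OF AB, of dim_col] by simp
  moreover have "dim_row B = n" using arg_cong[OF BA, of dim_col] A by simp
  ultimately have B: "B \<in> carrier_mat n n" by auto
  have "inf_norm_vec (B *\<^sub>v y) \<le> c" if y: "y \<in> carrier_vec n" "inf_norm_vec y = 1" for y
  proof -
    have "A *\<^sub>v (B *\<^sub>v y) = y"
      using assoc_mult_mat_vec[OF A B y(1)] y(1) by (simp add: AB)
    then have "cmod ((A *\<^sub>v (B *\<^sub>v y)) $ j) \<le> 1" if "j < n" for j
      using cmod_le_inf_norm_vec[of j y] y that by simp
    then have "cmod ((B *\<^sub>v y) $ i) \<le> c" if "i < n" for i
      using that B y by (intro bound) auto
    then show ?thesis using B n by (subst inf_norm_vec_le_iff) auto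
  qed
  moreover have "inf_norm_vec (vec n (\<lambda>_. 1)) = 1"
  proof -
    have "(\<lambda>i. cmod (vec n (\<lambda>_. 1) $ i)) ` {..<n} = {1}" using n by (auto simp: image_def)
    then show ?thesis by (simp add: inf_norm_vec_def)
  qed
  \<comment> \<open>The supremum of the empty set has no useful value, so a unit vector has to be exhibited.\<close>
  then have "{x \<in> carrier_vec n. inf_norm_vec x = 1} \<noteq> {}" using vec_carrier by blast
  ultimately show ?thesis
    unfolding inf_norm_mat_def using B by (intro cSUP_least) auto
qed

theorem theorem15:
  fixes A :: "complex mat" and n :: nat and a11 h1 \<delta> zmax :: real
  defines "a11 \<equiv> cmod (A $$ (0,0))"
    and "h1 \<equiv> row_h A 0"
    and "\<delta> \<equiv> (MIN i\<in>{1..<n}. cmod (A $$ (i,i)) - row_h A i)"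
    and "zmax \<equiv> (MAX i\<in>{..<n}. row_z A i)"
  assumes "n \<ge> 2"
    and "A \<in> carrier_mat n n"
    and "nekrasov A"
    and "a11 - h1 < \<delta>"
  shows
    \<comment> \<open>The minimum over \<open>\<mu>\<close> is attained and has the stated value. The last inequality is strict
      unless all off-diagonal entries of the first row vanish, in which case equality holds:
      for the diagonal matrix with entries 1 and 2, both sides are 1.\<close>
    "((\<delta> + h1) / (a11 * \<delta>)
        \<in> (\<lambda>\<mu>. max \<mu> 1 / min (\<mu> * a11 - h1) \<delta>) ` {1<..<\<delta> / (a11 - h1)}
      \<and> (\<forall>\<mu>\<in>{1<..<\<delta> / (a11 - h1)}.
           (\<delta> + h1) / (a11 * \<delta>) \<le> max \<mu> 1 / min (\<mu> * a11 - h1) \<delta>))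
     \<and> invertible_mat A
     \<and> (\<forall>B. inverts_mat A B \<and> inverts_mat B A \<longrightarrow>
           inf_norm_mat B \<le> zmax * (\<delta> + h1) / (a11 * \<delta>))
     \<and> zmax * (\<delta> + h1) / (a11 * \<delta>)
         \<le> zmax / (MIN i\<in>{..<n}. cmod (A $$ (i,i)) - row_h A i)
     \<and> (h1 \<noteq> 0 \<longrightarrow>
         zmax * (\<delta> + h1) / (a11 * \<delta>)
         < zmax / (MIN i\<in>{..<n}. cmod (A $$ (i,i)) - row_h A i))"
proof -
  let ?gap = "\<lambda>i. cmod (A $$ (i,i)) - row_h A i"
  have n: "2 \<le> n" and A: "A \<in> carrier_mat n n" and nk: "nekrasov A" and lt: "a11 - h1 < \<delta>"
    using assms by auto
  have h1: "0 \<le> h1" by (simp add: h1_def row_h_nonneg)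
  have a11: "h1 < a11"
    unfolding h1_def a11_def using nekrasov_row_gap_pos[OF A nk, of 0] n by simp
  have \<delta>0: "0 < \<delta>" using lt a11 by linarith
  have \<delta>_le: "\<delta> \<le> ?gap j" if "0 < j" "j < n" for j
    unfolding \<delta>_def using that by (intro Min_le) auto
  have zmax_ge: "row_z A j \<le> zmax" if "j < n" for j
    unfolding zmax_def using that by (intro Max_ge) auto
  have zmax1: "1 \<le> zmax" using zmax_ge[of 0] n by (simp add: row_z_first)
  have min: "(MIN i\<in>{..<n}. ?gap i) = a11 - h1"
  proof (rule Min_eqI)
    fix y assume "y \<in> ?gap ` {..<n}"
    then obtain j where j: "j < n" "y = ?gap j" by auto
    then show "a11 - h1 \<le> y"
      using \<delta>_le[of j] lt by (cases "j = 0") (auto simp: a11_def h1_def)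
  qed (use n in \<open>auto simp: a11_def h1_def intro!: image_eqI[of _ _ 0]\<close>)
  have bound: "cmod (x $ i) \<le> zmax * (\<delta> + h1) / (a11 * \<delta>) * Y"
    if "x \<in> carrier_vec n" "\<And>j. j < n \<Longrightarrow> cmod ((A *\<^sub>v x) $ j) \<le> Y" "i < n" for x i Y
    using nekrasov_solution_bound[OF n A nk that(1,2) \<delta>0 \<delta>_le zmax_ge _ that(3)] lt
    by (simp add: a11_def h1_def)
  have invertible: "invertible_mat A"
  proof (rule invertible_mat_if_trivial_kernel[OF A])
    fix v :: "complex vec"
    assume v: "v \<in> carrier_vec n" and "A *\<^sub>v v = 0\<^sub>v n"
    then have "cmod (v $ i) \<le> 0" if "i < n" for i
      using bound[OF v _ that, of 0] by simp
    then show "v = 0\<^sub>v n" using v by (intro eq_vecI) auto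
  qed
  have norm: "inf_norm_mat B \<le> zmax * (\<delta> + h1) / (a11 * \<delta>)"
    if "inverts_mat A B" "inverts_mat B A" for B
    using inf_norm_inverse_le[OF A _ that] bound[where Y = 1] n by simp
  \<comment> \<open>Clearing denominators, the gap between the two bounds is \<open>zmax h1 (\<delta> - (a11 - h1))\<close>.\<close>
  have diff: "zmax / (a11 - h1) - zmax * (\<delta> + h1) / (a11 * \<delta>)
      = zmax * (h1 * (\<delta> - (a11 - h1))) / ((a11 - h1) * (a11 * \<delta>))"
    using a11 h1 \<delta>0 by (simp add: divide_simps) (simp add: algebra_simps)
  have denom: "0 < (a11 - h1) * (a11 * \<delta>)" using a11 h1 \<delta>0 by simp
  have le: "zmax * (\<delta> + h1) / (a11 * \<delta>) \<le> zmax / (a11 - h1)"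
  proof -
    have "0 \<le> zmax * (h1 * (\<delta> - (a11 - h1))) / ((a11 - h1) * (a11 * \<delta>))"
      using denom zmax1 h1 lt by (intro divide_nonneg_pos mult_nonneg_nonneg) auto
    then show ?thesis using diff by linarith
  qed
  have less: "zmax * (\<delta> + h1) / (a11 * \<delta>) < zmax / (a11 - h1)" if "h1 \<noteq> 0"
  proof -
    have "0 < zmax * (h1 * (\<delta> - (a11 - h1))) / ((a11 - h1) * (a11 * \<delta>))"
      using denom zmax1 h1 that lt by (intro divide_pos_pos[OF _ denom] mult_pos_pos) auto
    then show ?thesis using diff by linarith
  qed
  show ?thesis
    unfolding min
    using scaling_optimum_attained[OF h1 a11 lt] scaling_optimum_lower_bound[OF h1 a11 \<delta>0]
      invertible norm le less
    by auto
qed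

end
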